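(* Let $n$ be a positive integer with prime factorization \[ n=2^{a}3^{b}5^{c}\prod_{i=1}^{y}p_i^{v_i}\prod_{j=1}^{s}q_j^{w_j}, \] where each $p_i$ satisfies $3<p_i\equiv 1,3,7,9\pmod{20}$ and each $q_j\equiv 11,13,17,19\pmod{20}$. Define $\Lambda(n)=\prod_{i=1}^{y}(1+v_i)\prod_{j=1}^{s}\frac{1+(-1)^{w_j}}{2}$. Let $t_1$, $t_2$, $t_3$ be the number of prime factors of $n$, counted with multiplicity, that are congruent to $3,7\pmod{20}$, to $23,29,41,47\pmod{60}$, and to $7,29,41,43\pmod{60}$, respectively. Then \[ (1,0,45;n)=\begin{cases}\tfrac12\left(1+(-1)^{a+t_1}+(-1)^{a+c+t_2}+(-1)^{c+t_3}\right)\Lambda(n), & b=0,\\ (b-1)(1+(-1)^{a+t_1})\Lambda(n), & b>0,\end{cases} \] \[ (5,0,9;n)=\begin{cases}\tfrac12\left(1+(-1)^{a+t_1}-(-1)^{a+c+t_2}-(-1)^{c+t_3}\right)\Lambda(n), & b=0,\\ (b-1)(1+(-1)^{a+t_1})\Lambda(n), & b>0,\end{cases} \] \[ (7,4,7;n)=\begin{cases}\tfrac12\left(1-(-1)^{a+t_1}+(-1)^{a+c+t_2}-(-1)^{c+t_3}\right)\Lambda(n), & b=0,\\ (b-1)(1-(-1)^{a+t_1})\Lambda(n), & b>0,\end{cases} \] \[ (2,2,23;n)=\begin{cases}\tfrac12\left(1-(-1)^{a+t_1}-(-1)^{a+c+t_2}+(-1)^{c+t_3}\right)\Lambda(n), &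 b=0,\\ (b-1)(1-(-1)^{a+t_1})\Lambda(n), & b>0.\end{cases} \]
   Context: For a binary quadratic form $(a,b,c)$, i.e. $ax^2+bxy+cy^2$, the quantity $(a,b,c;n)$ denotes the number of pairs $(x,y)\in\mathbb{Z}^2$ with $ax^2+bxy+cy^2=n$. *)

theory Defs
  imports Complex_Main "HOL-Computational_Algebra.Primes"
begin

definition form_reps :: "int \<Rightarrow> int \<Rightarrow> int \<Rightarrow> nat \<Rightarrow> nat" where
  "form_reps a b c n =
     card {(x :: int, y :: int). a * x\<^sup>2 + b * x * y + c * y\<^sup>2 = int n}"

text \<open>
  For positive definite forms the set counted in \<^const>\<open>form_reps\<close> is finite, so its cardinality
  is never the default value 0 that \<^const>\<open>card\<close> assigns to infinite sets.
\<close>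

lemma finite_form_reps:
  fixes a b c :: int
  assumes "a > 0" "4 * a * c - b\<^sup>2 > 0"
  shows "finite {(x :: int, y :: int). a * x\<^sup>2 + b * x * y + c * y\<^sup>2 = int n}"
proof (rule finite_subset)
  have bound: "\<bar>z\<bar> \<le> k" if "d * z\<^sup>2 \<le> k" "d > 0" for d z k :: int
  proof -
    have "\<bar>z\<bar> * 1 \<le> \<bar>z\<bar> * \<bar>z\<bar>"
      by (cases "z = 0") (auto intro!: mult_left_mono simp del: abs_mult_self_eq mult_1_right)
    then have "\<bar>z\<bar> \<le> z\<^sup>2"
      by (simp add: power2_eq_square)
    also have "z\<^sup>2 \<le> d * z\<^sup>2"
      using that(2) by (simp add: mult_le_cancel_right1)
    finally show ?thesis
      using that(1) by simp
  qed
  show "{(x :: int, y :: int). a * x\<^sup>2 + b * x * y + c * y\<^sup>2 = int n}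
          \<subseteq> {-(4 * c * int n)..4 * c * int n} \<times> {-(4 * a * int n)..4 * a * int n}"
  proof clarify
    fix x y :: int
    assume eq: "a * x\<^sup>2 + b * x * y + c * y\<^sup>2 = int n"
    have "(2 * a * x + b * y)\<^sup>2 + (4 * a * c - b\<^sup>2) * y\<^sup>2 = 4 * a * int n"
      unfolding eq[symmetric] by (simp add: power2_eq_square algebra_simps)
    then have y: "(4 * a * c - b\<^sup>2) * y\<^sup>2 \<le> 4 * a * int n"
      using zero_le_power2[of "2 * a * x + b * y"] by linarith
    have "(2 * c * y + b * x)\<^sup>2 + (4 * a * c - b\<^sup>2) * x\<^sup>2 = 4 * c * int n"
      unfolding eq[symmetric] by (simp add: power2_eq_square algebra_simps)
    then have x: "(4 * a * c - b\<^sup>2) * x\<^sup>2 \<le> 4 * c * int n"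
      using zero_le_power2[of "2 * c * y + b * x"] by linarith
    show "x \<in> {-(4 * c * int n)..4 * c * int n} \<and> y \<in> {-(4 * a * int n)..4 * a * int n}"
      using bound[OF x assms(2)] bound[OF y assms(2)] by auto
  qed
qed simp

definition Lambda :: "nat \<Rightarrow> real" where
  "Lambda n =
     (\<Prod>p\<in>{p \<in> prime_factors n. 3 < p \<and> p mod 20 \<in> {1, 3, 7, 9}}. 1 + real (multiplicity p n)) *
     (\<Prod>q\<in>{q \<in> prime_factors n. q mod 20 \<in> {11, 13, 17, 19}}. (1 + (-1) ^ multiplicity q n) / 2)"

text \<open>
  Prime factors are counted with multiplicity. In particular, the prime 3 contributes to
  \<open>num_prime_factors_mod 20 {3, 7} n\<close>.
\<close>

definition num_prime_factors_mod :: "nat \<Rightarrow> nat set \<Rightarrow> nat \<Rightarrow> nat" where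
  "num_prime_factors_mod m R n = size {#p \<in># prime_factorization n. p mod m \<in> R#}"

end

theory Submission
  imports
    Defs
    "HOL-Number_Theory.Quadratic_Reciprocity"
    "HOL-Library.Discrete_Functions"
begin

text \<open>
  All four forms are counted through \<open>x\<^sup>2 + 5y\<^sup>2\<close>. The solutions of \<open>x\<^sup>2 + 5y\<^sup>2 = n\<close> with
  \<open>3\<close> dividing \<open>y\<close> (resp. \<open>x\<close>) are the representations of \<open>n\<close> by \<open>(1,0,45)\<close> (resp. \<open>(5,0,9)\<close>), and
  those of \<open>x\<^sup>2 + 5y\<^sup>2 = 2n\<close> are the representations of \<open>n\<close> by \<open>(2,2,23)\<close> (resp. \<open>(7,4,7)\<close>).
  The residue of \<open>n\<close> modulo \<open>3\<close> decides which divisibility condition holds. If \<open>3\<close> divides \<open>n\<close>,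
  the conditions are equivalent and the count is that of \<open>n/9\<close>.

  Let \<open>R(N)\<close> be the number of solutions of \<open>x\<^sup>2 + 5y\<^sup>2 = N\<close>. Then \<open>R(4m) = R(5m) = R(m)\<close>. For a prime
  \<open>q\<close> modulo which \<open>-5\<close> is not a square, \<open>R(q\<^sup>2m) = R(m)\<close>, and \<open>R(qm) = 0\<close> if \<open>q\<close> does not divide
  \<open>m\<close>. For any other prime \<open>p\<close> besides \<open>2\<close> and \<open>5\<close>, Thue's lemma gives \<open>kp = u\<^sup>2 + 5v\<^sup>2\<close> with
  \<open>k = 1\<close> or \<open>k = 2\<close>, and \<open>R(pm) + R(m/p) = 2R(km)\<close>, where \<open>R(m/p) = 0\<close> if \<open>p\<close> does not divide \<open>m\<close>.
  These relations determine \<open>R(n)\<close> and \<open>R(2n)\<close> together by induction on \<open>n\<close>.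
\<close>

section \<open>Small multiples of primes represented by the form\<close>

lemma Legendre_mod_5:
  assumes "\<not> 5 dvd a"
  shows "Legendre a 5 = (if a mod 5 \<in> {1, 4} then 1 else -1)"
proof -
  have "y\<^sup>2 mod 5 \<in> {0, 1, 4}" for y :: int
  proof -
    have "y mod 5 \<in> {0, 1, 2, 3, 4}" by auto
    then have "(y mod 5)\<^sup>2 mod 5 \<in> {0, 1, 4}" by auto
    then show ?thesis by (simp add: power_mod)
  qed
  then have 1: "a mod 5 \<in> {0, 1, 4}" if "QuadRes 5 a"
    using that unfolding QuadRes_def cong_def by metis
  have 2: "QuadRes 5 a" if "a mod 5 \<in> {1, 4}"
  proof -
    have "1\<^sup>2 mod 5 = a mod 5 \<or> 2\<^sup>2 mod 5 = a mod 5" using that by auto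
    then show ?thesis unfolding QuadRes_def cong_def by metis
  qed
  have "a mod 5 \<noteq> 0" using assms by (simp add: dvd_eq_mod_eq_0)
  then show ?thesis
    using 1 2 by (auto simp: Legendre_def cong_def)
qed

text \<open>Since 5 is 1 modulo 4, reciprocity swaps \<open>p\<close> and 5 without a sign, and
  Euler's criterion splits off the factor -1. Both sides are 1 or -1, so their congruence modulo
  \<open>p\<close> > 2 is an equality.\<close>

lemma Legendre_minus_5:
  fixes p :: nat
  assumes p: "prime p" "2 < p" "p \<noteq> 5"
  shows "Legendre (-5) p = (-1) ^ ((p - 1) div 2) * Legendre p 5"
proof -
  let ?h = "(p - 1) div 2"
  have p5: "\<not> int p dvd 5" "\<not> 5 dvd int p"
    using p primes_dvd_imp_eq[of p 5] primes_dvd_imp_eq[of 5 p]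
      by (auto simp: int_dvd_int_iff[of _ 5, simplified] int_dvd_int_iff[of 5, simplified])
  have "Legendre p 5 * Legendre 5 p = 1"
    using Quadratic_Reciprocity[of p 5] p by simp
  moreover have "Legendre p 5 \<in> {1, -1}"
    using p5 by (simp add: Legendre_mod_5)
  ultimately have eq: "Legendre 5 p = Legendre p 5" by auto
  have "[Legendre (-5) p = (-5) ^ ?h] (mod p)"
    using p by (intro euler_criterion) auto
  moreover have "[(-1) ^ ?h * 5 ^ ?h = (-1) ^ ?h * Legendre 5 p] (mod p)"
    using euler_criterion[of p 5] p by (intro cong_mult cong_refl) (auto simp: cong_sym)
  moreover have "(-5 :: int) ^ ?h = (-1) ^ ?h * 5 ^ ?h"
    by (simp flip: power_mult_distrib)
  ultimately have "[Legendre (-5) p = (-1) ^ ?h * Legendre p 5] (mod p)"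
    unfolding eq by (metis cong_trans)
  then have d: "int p dvd Legendre (-5) p - (-1) ^ ?h * Legendre p 5"
    by (simp add: cong_iff_dvd_diff)
  have "\<not> [-5 = 0] (mod int p)"
    using p5 by (simp add: cong_0_iff)
  then have "Legendre (-5) p \<in> {1, -1}"
    by (simp add: Legendre_def)
  moreover have "(-1) ^ ?h * Legendre p 5 \<in> {1, -1 :: int}"
    using \<open>Legendre p 5 \<in> _\<close> by (cases "even ?h") auto
  ultimately have "\<bar>Legendre (-5) p - (-1) ^ ?h * Legendre p 5\<bar> \<le> 2"
    by auto
  with d \<open>2 < p\<close> show ?thesis
    using dvd_imp_le_int[of "Legendre (-5) p - (-1) ^ ?h * Legendre p 5" "int p"] by force
qed

text \<open>By the preceding formula, -5 is a square exactly when "p is 1 modulo 4" and "p is 1 or 4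
  modulo 5" both hold or both fail. Reading this off modulo 20 gives the four classes.\<close>

lemma minus_5_square_mod_prime_iff:
  fixes p :: nat
  assumes p: "prime p" "2 < p" "p \<noteq> 5"
  shows "(\<exists>r. int p dvd r\<^sup>2 + 5) \<longleftrightarrow> p mod 20 \<in> {1, 3, 7, 9}"
proof -
  have odd: "odd p" and p5: "\<not> 5 dvd p"
    using p primes_dvd_imp_eq[of 5 p] prime_odd_nat by auto
  have n0: "\<not> [-5 = 0] (mod int p)"
    using p primes_dvd_imp_eq[of p 5]
    by (auto simp: cong_0_iff int_dvd_int_iff[of _ 5, simplified])
  have "(\<exists>r. int p dvd r\<^sup>2 + 5) \<longleftrightarrow> QuadRes p (-5)"
    by (simp add: QuadRes_def cong_iff_dvd_diff)
  also have "\<dots> \<longleftrightarrow> Legendre (-5) p = 1"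
    using n0 by (simp add: Legendre_def)
  also have "\<dots> \<longleftrightarrow> (-1) ^ ((p - 1) div 2) * (if p mod 5 \<in> {1, 4} then 1 else -1) = (1 :: int)"
    using p p5 by (simp add: Legendre_minus_5 Legendre_mod_5 
      int_dvd_int_iff[of 5, simplified] zmod_int[of _ 5, simplified, symmetric])
  also have "\<dots> \<longleftrightarrow> (even ((p - 1) div 2) \<longleftrightarrow> p mod 5 \<in> {1, 4})"
    by (cases "even ((p - 1) div 2)") auto
  also have "\<dots> \<longleftrightarrow> (p mod 4 = 1 \<longleftrightarrow> p mod 5 \<in> {1, 4})"
  proof -
    have "even ((p - 1) div 2) \<longleftrightarrow> p mod 4 = 1" using odd by presburger
    then show ?thesis by simp
  qed
  also have "\<dots> \<longleftrightarrow> p mod 20 \<in> {1, 3, 7, 9}"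
  proof -
    define r where "r = p mod 20"
    have eqs: "p mod 4 = r mod 4" "p mod 5 = r mod 5" "p mod 2 = r mod 2"
      unfolding r_def by (simp_all add: mod_mod_cancel)
    have "r mod 2 = 1" "r mod 5 \<noteq> 0"
      using odd p5 unfolding eqs[symmetric] by presburger+
    moreover have "r \<in> set [0..<20]" by (simp add: r_def)
    ultimately show ?thesis
      unfolding eqs r_def[symmetric] by (auto simp: upt_rec)
  qed
  finally show ?thesis .
qed

text \<open>Pigeonhole: with \<open>s\<close> the integer square root of \<open>p\<close>, there are
  more than \<open>p\<close> pairs with coordinates between 0 and \<open>s\<close>, so two of them
  agree in \<open>i - r * j\<close> modulo \<open>p\<close>. Their difference is the required
  vector.\<close>

lemma thue:
  fixes p :: nat and r :: int
  assumes "prime p"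
  obtains x y :: int where "int p dvd x - r * y" "x\<^sup>2 < p" "y\<^sup>2 < p" "x \<noteq> 0 \<or> y \<noteq> 0"
proof -
  define s where "s = floor_sqrt p"
  have s1: "p < (s + 1)\<^sup>2" and s2: "s\<^sup>2 \<le> p"
    unfolding s_def using Suc_floor_sqrt_power2_gt[of p] by simp_all
  \<comment> \<open>A prime is not a square; this makes the bounds on \<open>x\<close> and
    \<open>y\<close> strict.\<close>
  have "s\<^sup>2 \<noteq> p"
    using assms prime_power_iff[of s 2] by auto
  with s2 have s3: "int s ^ 2 < int p"
    by (simp flip: of_nat_power)
  define f where "f = (\<lambda>(i, j). (i - r * j) mod int p)"
  let ?A = "{0..int s} \<times> {0..int s}"
  have "f ` ?A \<subseteq> {0..<int p}"
    using assms prime_gt_0_nat[of p] by (auto simp: f_def)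
  then have "card (f ` ?A) \<le> p"
    using card_mono[of "{0..<int p}" "f ` ?A"] by simp
  also have "p < card ?A"
    using s1 by (simp add: power2_eq_square nat_add_distrib)
  finally have "\<not> inj_on f ?A"
    by (rule pigeonhole)
  then obtain i j i' j' where ij: "i \<in> {0..int s}" "j \<in> {0..int s}" "i' \<in> {0..int s}" "j' \<in> {0..int s}"
    "f (i, j) = f (i', j')" "(i, j) \<noteq> (i', j')"
    unfolding inj_on_def by auto
  have sq: "z\<^sup>2 < int p" if "\<bar>z\<bar> \<le> int s" for z
    using power_mono[OF that abs_ge_zero, of 2] s3 unfolding power2_abs by (rule le_less_trans)
  have "int p dvd (i - r * j) - (i' - r * j')"
    using ij(5) by (simp add: f_def mod_eq_dvd_iff)
  then have "int p dvd (i - i') - r * (j - j')"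
    by (simp add: algebra_simps)
  then show ?thesis
    using ij by (intro that[of "i - i'" "j - j'"] sq) auto
qed

text \<open>With \<open>r\<close> a square root of -5 modulo \<open>p\<close>, Thue's vector
  satisfies x = ry, so x^2 + 5y^2 = (r^2 + 5)y^2 = 0 modulo \<open>p\<close>. The size bounds put
  this value strictly between 0 and 6p.\<close>

lemma small_multiple_of_form:
  fixes p :: nat
  assumes p: "prime p" "2 < p" "p mod 20 \<in> {1, 3, 7, 9}"
  obtains u v :: int and k :: int where "k \<in> {1, 2, 3, 4, 5}" "u\<^sup>2 + 5 * v\<^sup>2 = k * p"
proof -
  have "p \<noteq> 5" using p by auto
  then obtain r where r: "int p dvd r\<^sup>2 + 5"
    using minus_5_square_mod_prime_iff p by metis
  obtain x y where xy: "int p dvd x - r * y" "x\<^sup>2 < p" "y\<^sup>2 < p" "x \<noteq> 0 \<or> y \<noteq> 0"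
    using thue[OF p(1)] .
  have "x\<^sup>2 + 5 * y\<^sup>2 = (x - r * y) * (x + r * y) + (r\<^sup>2 + 5) * y\<^sup>2"
    by (simp add: power2_eq_square algebra_simps)
  then have "int p dvd x\<^sup>2 + 5 * y\<^sup>2"
    using xy(1) r by simp
  then obtain k where "x\<^sup>2 + 5 * y\<^sup>2 = int p * k" by (rule dvdE)
  then have k: "x\<^sup>2 + 5 * y\<^sup>2 = k * p" by (simp add: mult.commute)
  have "0 < x\<^sup>2 + 5 * y\<^sup>2"
    using xy(4)
  proof
    assume "x \<noteq> 0"
    then show ?thesis by (intro add_pos_nonneg) auto
  next
    assume "y \<noteq> 0"
    then show ?thesis by (intro add_nonneg_pos) auto
  qed
  moreover have "k * p < 6 * p"
    unfolding k[symmetric] using xy by linarith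
  ultimately have "0 < k" "k < 6"
    using p unfolding k by (auto simp: zero_less_mult_iff)
  then have "k \<in> {1, 2, 3, 4, 5}" by auto
  then show ?thesis using that k by blast
qed

text \<open>Mixed parity gives an odd value, and two odd coordinates give a value that is 2 modulo
  4.\<close>

lemma four_dvd_form:
  fixes x y :: int
  assumes "4 dvd x\<^sup>2 + 5 * y\<^sup>2"
  shows "even x \<and> even y"
proof -
  from assms obtain m where m: "x\<^sup>2 + 5 * y\<^sup>2 = 4 * m" by (rule dvdE)
  have "even (x\<^sup>2 + 5 * y\<^sup>2)" unfolding m by simp
  then have e: "even x \<longleftrightarrow> even y" by simp
  moreover have "even x"
  proof (rule ccontr)
    assume "odd x"
    moreover with e have "odd y" by simp
    ultimately obtain a b where "x = 2 * a + 1" "y = 2 * b + 1" by (auto elim!: oddE)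
    then have "4 * (a\<^sup>2 + a + 5 * b\<^sup>2 + 5 * b) + 6 = 4 * m"
      using m by (simp add: power2_eq_square algebra_simps)
    then show False by presburger
  qed
  ultimately show ?thesis by blast
qed

text \<open>The multipliers 3, 4 and 5 can be removed. For 4 one divides u + v sqrt(-5) by 2, for 5
  by sqrt(-5), up to sign; multiplier 3 is traded for 2 by means of 1 + sqrt(-5), which has norm
  6.\<close>

lemma prime_or_double_prime_form:
  fixes p :: nat
  assumes p: "prime p" "2 < p" "p mod 20 \<in> {1, 3, 7, 9}"
  obtains u v :: int and k :: nat where "k \<in> {1, 2}" "u\<^sup>2 + 5 * v\<^sup>2 = k * p"
proof -
  note thatI = that
  obtain u v k :: int where k: "k \<in> {1, 2, 3, 4, 5}" and uv: "u\<^sup>2 + 5 * v\<^sup>2 = k * p"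
    using small_multiple_of_form[OF p] .
  consider "k = 1" | "k = 2" | "k = 3" | "k = 4" | "k = 5" using k by blast
  then show ?thesis
  proof cases
    case 1 then show ?thesis using that[of 1 u v] uv by simp
  next
    case 2 then show ?thesis using that[of 2 u v] uv by simp
  next
    case 3
    \<comment> \<open>Here \<open>w\<close> is \<open>v\<close> or \<open>-v\<close>, whichever
      makes 3 divide \<open>u + w\<close>. Then (u + w sqrt(-5))(1 + sqrt(-5)) / 3 has the integral
      coordinates \<open>t - 2 * w\<close> and \<open>t\<close>, and its norm is 6 * 3p / 9 =
      2p.\<close>
    have main: thesis if "3 dvd u + w" "u\<^sup>2 + 5 * w\<^sup>2 = 3 * p" for w
    proof -
      from that(1) obtain t where "u + w = 3 * t" by (rule dvdE)
      then have u: "u = 3 * t - w" by simp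
      have "(t - 2 * w)\<^sup>2 + 5 * t\<^sup>2 = 2 * p"
        using that(2) unfolding u by (simp add: power2_eq_square algebra_simps)
      then show ?thesis using thatI[of 2 "t - 2 * w" t] by simp
    qed
    have "(u + v) * (u - v) = 3 * (p - 2 * v\<^sup>2)"
      using uv 3 by (simp add: power2_eq_square algebra_simps)
    then have "3 dvd (u + v) * (u - v)" by simp
    then have "3 dvd u + v \<or> 3 dvd u + - v"
      using prime_dvd_mult_iff[of "3 :: int"] by simp
    then show ?thesis using main[of v] main[of "- v"] uv 3 by auto
  next
    case 4
    have "even u \<and> even v"
      by (rule four_dvd_form) (simp add: uv 4)
    then obtain a b where "u = 2 * a" "v = 2 * b" by (metis evenE)
    then have "a\<^sup>2 + 5 * b\<^sup>2 = p"
      using uv 4 by (simp add: power2_eq_square algebra_simps)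
    then show ?thesis using that[of 1 a b] by simp
  next
    case 5
    have "u\<^sup>2 = 5 * (p - v\<^sup>2)" using uv 5 by simp
    then have "5 dvd u" using prime_dvd_power[of "5 :: int" u 2] by simp
    then obtain a where "u = 5 * a" by auto
    then have "v\<^sup>2 + 5 * a\<^sup>2 = p"
      using uv 5 by (simp add: power2_eq_square algebra_simps)
    then show ?thesis using that[of 1 v a] by simp
  qed
qed

text \<open>The form takes no value that is 2, 3, 7 or 18 modulo 20. So p = 3, 7 rules out k = 1,
  and p = 1, 9 rules out k = 2. This separates the two genera of discriminant -20.\<close>

lemma form_multiplier_eq_1_iff:
  fixes p k :: nat
  assumes p: "p mod 20 \<in> {1, 3, 7, 9}" and k: "k \<in> {1, 2}" and uv: "u\<^sup>2 + 5 * v\<^sup>2 = int k * int p"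
  shows "k = 1 \<longleftrightarrow> p mod 20 \<notin> {3, 7}"
proof -
  have sq: "u\<^sup>2 mod 20 \<in> {0, 1, 4, 5, 9, 16}" for u :: int
  proof -
    have "u mod 20 \<in> set [0..19]" by simp
    then have "(u mod 20)\<^sup>2 mod 20 \<in> {0, 1, 4, 5, 9, 16}" by (auto simp: upto_rec1)
    then show ?thesis by (simp add: power_mod)
  qed
  have "(u\<^sup>2 + 5 * v\<^sup>2) mod 20 = (u\<^sup>2 mod 20 + 5 * (v\<^sup>2 mod 20)) mod 20"
    by (intro mod_add_cong mod_mult_cong) simp_all
  also have "\<dots> \<in> {0, 1, 4, 5, 6, 9, 10, 14, 16}"
    using sq[of u] sq[of v] by auto
  finally have *: "int k * (int p mod 20) mod 20 \<in> {0, 1, 4, 5, 6, 9, 10, 14, 16}"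
    unfolding uv mod_mult_right_eq .
  define r where "r = p mod 20"
  have r: "int p mod 20 = int r" unfolding r_def by (simp add: zmod_int)
  show ?thesis
  proof (cases "k = 1")
    case True
    with * p show ?thesis unfolding r r_def[symmetric] by auto
  next
    case False
    with k have "k = 2" by simp
    with * p show ?thesis unfolding r r_def[symmetric] by auto
  qed
qed

section \<open>Recursions for the number of representations\<close>

definition sols :: "nat \<Rightarrow> (int \<times> int) set" where
  "sols N = {(x, y). x\<^sup>2 + 5 * y\<^sup>2 = int N}"

lemma finite_sols [simp]: "finite (sols N)"
proof -
  have "(0 :: int) < 4 * 1 * 5 - 0\<^sup>2" by simp
  from finite_form_reps[OF zero_less_one this, of N] show ?thesis
    unfolding sols_def by (simp only: mult_1 mult_zero_left add_0_right)
qed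

lemma in_sols [simp]: "(x, y) \<in> sols N \<longleftrightarrow> x\<^sup>2 + 5 * y\<^sup>2 = int N"
  by (simp add: sols_def)

section \<open>Descent at 2, 5 and the inert primes\<close>

lemma card_sols_common_divisor:
  assumes "d > 0"
  shows "card {(x, y) \<in> sols (d\<^sup>2 * m). int d dvd x \<and> int d dvd y} = card (sols m)"
proof (rule sym, rule bij_betw_same_card)
  let ?f = "\<lambda>(x, y). (int d * x, int d * y)"
  have eq: "(int d * x)\<^sup>2 + 5 * (int d * y)\<^sup>2 = (int d)\<^sup>2 * (x\<^sup>2 + 5 * y\<^sup>2)" for x y
    by (simp add: power2_eq_square algebra_simps)
  show "bij_betw ?f (sols m) {(x, y) \<in> sols (d\<^sup>2 * m). int d dvd x \<and> int d dvd y}"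
    unfolding bij_betw_def
  proof
    show "inj_on ?f (sols m)"
      using assms by (auto simp: inj_on_def)
    show "?f ` sols m = {(x, y) \<in> sols (d\<^sup>2 * m). int d dvd x \<and> int d dvd y}"
      using assms by (auto simp: eq image_iff elim!: dvdE) 
  qed
qed

lemma card_sols_square_times:
  assumes "d > 0" and "\<And>x y. x\<^sup>2 + 5 * y\<^sup>2 = int (d\<^sup>2 * m) \<Longrightarrow> int d dvd x \<and> int d dvd y"
  shows "card (sols (d\<^sup>2 * m)) = card (sols m)"
proof -
  have "sols (d\<^sup>2 * m) = {(x, y) \<in> sols (d\<^sup>2 * m). int d dvd x \<and> int d dvd y}"
    using assms(2) by (auto simp del: of_nat_mult)
  from arg_cong[OF this, of card] card_sols_common_divisor[OF assms(1), of m] show ?thesis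
    by (rule trans)
qed

lemma card_sols_four_times: "card (sols (4 * m)) = card (sols m)"
proof -
  have "even x \<and> even y" if "x\<^sup>2 + 5 * y\<^sup>2 = 4 * int m" for x y :: int
    by (rule four_dvd_form) (simp add: that)
  then show ?thesis using card_sols_square_times[of 2 m] by simp
qed

lemma card_sols_five_times: "card (sols (5 * m)) = card (sols m)"
proof (rule sym, rule bij_betw_same_card)
  \<comment> \<open>Up to a sign, this multiplies x + y sqrt(-5) by sqrt(-5).\<close>
  let ?f = "\<lambda>(x, y). (5 * y :: int, x :: int)"
  have "\<exists>z. x = 5 * z \<and> y\<^sup>2 + 5 * z\<^sup>2 = int m" if "x\<^sup>2 + 5 * y\<^sup>2 = 5 * int m" for x y
  proof -
    have "x\<^sup>2 = 5 * (m - y\<^sup>2)" using that by simp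
    then have "5 dvd x" using prime_dvd_power[of "5 :: int" x 2] by simp
    then obtain z where "x = 5 * z" by (rule dvdE)
    with that show ?thesis by (auto simp: power2_eq_square)
  qed
  then show "bij_betw ?f (sols m) (sols (5 * m))"
    by (intro bij_betw_imageI) (force simp: inj_on_def image_iff power2_eq_square)+
qed

text \<open>If \<open>q\<close> did not divide \<open>y\<close>, then x / y would be a square root
  of -5 modulo \<open>q\<close>, which does not exist for these \<open>q\<close>.\<close>

lemma inert_prime_dvd_form:
  fixes q :: nat and x y :: int
  assumes q: "prime q" "2 < q" "q \<noteq> 5" "q mod 20 \<notin> {1, 3, 7, 9}" and dvd: "int q dvd x\<^sup>2 + 5 * y\<^sup>2"
  shows "int q dvd x \<and> int q dvd y"
proof -
  have pq: "prime (int q)" using q by simp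
  have y: "int q dvd y"
  proof (rule ccontr)
    assume "\<not> int q dvd y"
    then have "coprime y (int q)"
      using prime_imp_coprime[OF pq] by (simp add: coprime_commute)
    then obtain w where "[y * w = 1] (mod int q)"
      using cong_solve_coprime_int by blast
    then have "int q dvd y * w - 1" by (simp add: cong_iff_dvd_diff)
    \<comment> \<open>As \<open>w\<close> inverts \<open>y\<close> modulo \<open>q\<close>, the
      identity shows that \<open>x * w\<close> squares to -5.\<close>
    moreover have "(x * w)\<^sup>2 + 5 = w\<^sup>2 * (x\<^sup>2 + 5 * y\<^sup>2) - 5 * (y * w + 1) * (y * w - 1)"
      by (simp add: power2_eq_square algebra_simps)
    ultimately have "int q dvd (x * w)\<^sup>2 + 5"
      using dvd by (metis dvd_diff dvd_mult)
    then show False using minus_5_square_mod_prime_iff[OF q(1-3)] q(4) by blast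
  qed
  then have "int q dvd 5 * y\<^sup>2" by (simp add: power2_eq_square)
  with dvd have "int q dvd x\<^sup>2" by (metis dvd_add_left_iff)
  with y show ?thesis using prime_dvd_power[OF pq] by blast
qed

lemma card_sols_inert_square:
  assumes "prime q" "2 < q" "q \<noteq> 5" "q mod 20 \<notin> {1, 3, 7, 9}"
  shows "card (sols (q\<^sup>2 * m)) = card (sols m)"
proof (rule card_sols_square_times)
  show "0 < q" using assms by simp
  show "int q dvd x \<and> int q dvd y" if "x\<^sup>2 + 5 * y\<^sup>2 = int (q\<^sup>2 * m)" for x y
  proof (rule inert_prime_dvd_form[OF assms])
    show "int q dvd x\<^sup>2 + 5 * y\<^sup>2" unfolding that by (simp add: power2_eq_square)
  qed
qed

text \<open>In a solution both coordinates would be divisible by \<open>q\<close>, so q^2 would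
  divide \<open>q * m\<close>.\<close>

lemma sols_inert_empty:
  assumes q: "prime q" "2 < q" "q \<noteq> 5" "q mod 20 \<notin> {1, 3, 7, 9}" and m: "\<not> q dvd m"
  shows "sols (q * m) = {}"
proof -
  have False if xy: "x\<^sup>2 + 5 * y\<^sup>2 = int (q * m)" for x y
  proof -
    have "int q dvd x \<and> int q dvd y"
      by (rule inert_prime_dvd_form[OF q]) (simp add: xy)
    then obtain a b where "x = int q * a" "y = int q * b" by (auto elim!: dvdE)
    with xy have "int q * int m = int q * (int q * (a\<^sup>2 + 5 * b\<^sup>2))"
      by (simp add: power2_eq_square algebra_simps)
    then have "int m = int q * (a\<^sup>2 + 5 * b\<^sup>2)"
      using q by simp
    then have "int q dvd int m" by simp
    with m show False by simp
  qed
  then show ?thesis by (auto simp: sols_def)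
qed

text \<open>
  In terms of \<open>\<alpha> = x + y \<surd>-5\<close> and \<open>\<pi> = u + v \<surd>-5\<close>, the solutions with \<open>p\<close> dividing \<open>\<alpha> \<pi>'\<close>
  (where \<open>\<pi>'\<close> is the conjugate of \<open>\<pi>\<close>) correspond to elements of norm \<open>k m\<close> by \<open>\<alpha> \<mapsto> \<alpha> \<pi>' / p\<close>.
\<close>

lemma card_sols_half:
  fixes u v :: int
  assumes p: "prime p" and k: "k \<in> {1, 2}" and uv: "u\<^sup>2 + 5 * v\<^sup>2 = int k * int p"
  shows "card {(x, y) \<in> sols (p * m). int p dvd y * u - x * v} = card (sols (k * m))"
proof (rule bij_betw_same_card)
  let ?A = "{(x, y) \<in> sols (p * m). int p dvd y * u - x * v}"
  let ?f = "\<lambda>(x, y). ((x * u + 5 * y * v) div int p, (y * u - x * v) div int p)"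
  \<comment> \<open>The inverse map: if beta = alpha pi' / p, then alpha = beta pi / k, because pi
    pi' = k p.\<close>
  let ?g = "\<lambda>(s, t). ((s * u - 5 * t * v) div int k, (s * v + t * u) div int k)"
  have pp: "prime (int p)" "int p \<noteq> 0" and k0: "int k \<noteq> 0" using p k by auto
  have f: "?f (x, y) \<in> sols (k * m) \<and> ?g (?f (x, y)) = (x, y)" if "(x, y) \<in> ?A" for x y
  proof -
    have xy: "x\<^sup>2 + 5 * y\<^sup>2 = int p * int m" using that by simp
    from that obtain t where t: "y * u - x * v = int p * t" by (auto elim: dvdE)
    have norm: "(x * u + 5 * y * v)\<^sup>2 + 5 * (y * u - x * v)\<^sup>2 = (int p)\<^sup>2 * (int k * int m)"
    proof -
      have "(x * u + 5 * y * v)\<^sup>2 + 5 * (y * u - x * v)\<^sup>2 = (x\<^sup>2 + 5 * y\<^sup>2) * (u\<^sup>2 + 5 * v\<^sup>2)"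
        by (simp add: power2_eq_square algebra_simps)
      then show ?thesis unfolding xy uv by (simp add: power2_eq_square)
    qed
    \<comment> \<open>The norm of alpha pi' is divisible by p^2 and its second coordinate by
      \<open>p\<close>, so its first coordinate is divisible by \<open>p\<close> too.\<close>
    then have "(x * u + 5 * y * v)\<^sup>2 = int p * (int p * (int k * int m) - 5 * int p * t\<^sup>2)"
      unfolding t by (simp add: power2_eq_square algebra_simps)
    then have "int p dvd x * u + 5 * y * v"
      using prime_dvd_power[OF pp(1)] by (metis dvd_triv_left)
    then obtain s where s: "x * u + 5 * y * v = int p * s" by (rule dvdE)
    have "(int p)\<^sup>2 * (s\<^sup>2 + 5 * t\<^sup>2) = (int p)\<^sup>2 * (int k * int m)"
      using norm unfolding s t by (simp add: power2_eq_square algebra_simps)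
    then have 1: "s\<^sup>2 + 5 * t\<^sup>2 = int k * int m" using pp by simp
    have "int p * (s * u - 5 * t * v) = (x * u + 5 * y * v) * u - 5 * (y * u - x * v) * v"
      unfolding s t by (simp add: algebra_simps)
    also have "\<dots> = x * (u\<^sup>2 + 5 * v\<^sup>2)" by (simp add: power2_eq_square algebra_simps)
    finally have 2: "s * u - 5 * t * v = int k * x" unfolding uv using pp by simp
    have "int p * (s * v + t * u) = (x * u + 5 * y * v) * v + (y * u - x * v) * u"
      unfolding s t by (simp add: algebra_simps)
    also have "\<dots> = y * (u\<^sup>2 + 5 * v\<^sup>2)" by (simp add: power2_eq_square algebra_simps)
    finally have 3: "s * v + t * u = int k * y" unfolding uv using pp by simp
    show ?thesis using 1 2 3 pp k0 by (simp add: s t)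
  qed
  have g: "?g (s, t) \<in> ?A \<and> ?f (?g (s, t)) = (s, t)" if "(s, t) \<in> sols (k * m)" for s t
  proof -
    have st: "s\<^sup>2 + 5 * t\<^sup>2 = int k * int m" using that by simp
    \<comment> \<open>For \<open>k = 2\<close> both norms are even, so \<open>s\<close> and
      \<open>t\<close> have equal parity, and so do \<open>u\<close> and \<open>v\<close>. Hence
      both coordinates of beta pi are even.\<close>
    have "int k dvd s * u - 5 * t * v \<and> int k dvd s * v + t * u"
    proof (cases "k = 1")
      case False
      with k have k2: "k = 2" by simp
      have "even (s\<^sup>2 + 5 * t\<^sup>2)" "even (u\<^sup>2 + 5 * v\<^sup>2)" unfolding st uv k2 by simp_all
      then show ?thesis unfolding k2 by auto
    qed simp
    then obtain x y where x: "s * u - 5 * t * v = int k * x" and y: "s * v + t * u = int k * y"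
      by (metis dvdE)
    have "(int k)\<^sup>2 * (x\<^sup>2 + 5 * y\<^sup>2) = (int k * x)\<^sup>2 + 5 * (int k * y)\<^sup>2"
      by (simp add: power2_eq_square algebra_simps)
    also have "\<dots> = (s\<^sup>2 + 5 * t\<^sup>2) * (u\<^sup>2 + 5 * v\<^sup>2)"
      unfolding x[symmetric] y[symmetric] by (simp add: power2_eq_square algebra_simps)
    also have "\<dots> = (int k)\<^sup>2 * (int p * int m)"
      unfolding st uv by (simp add: power2_eq_square)
    finally have 1: "x\<^sup>2 + 5 * y\<^sup>2 = int p * int m" using k0 by simp
    have "int k * (x * u + 5 * y * v) = (int k * x) * u + 5 * (int k * y) * v"
      by (simp add: algebra_simps)
    also have "\<dots> = s * (u\<^sup>2 + 5 * v\<^sup>2)"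
      unfolding x[symmetric] y[symmetric] by (simp add: power2_eq_square algebra_simps)
    finally have 2: "x * u + 5 * y * v = int p * s" unfolding uv using k0 by simp
    have "int k * (y * u - x * v) = (int k * y) * u - (int k * x) * v"
      by (simp add: algebra_simps)
    also have "\<dots> = t * (u\<^sup>2 + 5 * v\<^sup>2)"
      unfolding x[symmetric] y[symmetric] by (simp add: power2_eq_square algebra_simps)
    finally have 3: "y * u - x * v = int p * t" unfolding uv using k0 by simp
    show ?thesis using 1 2 3 pp k0 by (simp add: x y)
  qed
  have f': "?f a \<in> sols (k * m) \<and> ?g (?f a) = a" if "a \<in> ?A" for a
    using f[of "fst a" "snd a"] that by (simp only: prod.collapse)
  have g': "?g b \<in> ?A \<and> ?f (?g b) = b" if "b \<in> sols (k * m)" for b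
    using g[of "fst b" "snd b"] that by (simp only: prod.collapse)
  show "bij_betw ?f ?A (sols (k * m))"
  proof (rule bij_betw_byWitness[where f' = ?g])
    show "\<forall>a\<in>?A. ?g (?f a) = a" by (intro ballI conjunct2[OF f'])
    show "\<forall>b\<in>sols (k * m). ?f (?g b) = b" by (intro ballI conjunct2[OF g'])
    show "?f ` ?A \<subseteq> sols (k * m)" by (intro image_subsetI conjunct1[OF f'])
    show "?g ` sols (k * m) \<subseteq> ?A" by (intro image_subsetI conjunct1[OF g'])
  qed
qed

text \<open>For every solution alpha, \<open>p\<close> divides alpha pi' or alpha pi. Each case
  accounts for R(km) solutions, and they overlap exactly where \<open>p\<close> divides alpha, which
  accounts for R(m/p). The relation is inclusion-exclusion.\<close>

lemma card_sols_split_prime: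
  fixes u v :: int
  assumes p: "prime p" "2 < p" "p \<noteq> 5" and k: "k \<in> {1, 2}" and uv: "u\<^sup>2 + 5 * v\<^sup>2 = int k * int p"
  shows "card (sols (p * m)) + (if p dvd m then card (sols (m div p)) else 0) = 2 * card (sols (k * m))"
proof -
  let ?A = "\<lambda>v. {(x, y) \<in> sols (p * m). int p dvd y * u - x * v}"
  let ?B = "{(x, y) \<in> sols (p * m). int p dvd y * u + x * v}"
  have pp: "prime (int p)" using p by simp
  have p10: "\<not> int p dvd 5" "\<not> int p dvd 2"
    using p primes_dvd_imp_eq[of p 5] primes_dvd_imp_eq[of p 2]
    by (auto simp: int_dvd_int_iff[of _ 5, simplified] int_dvd_int_iff[of _ 2, simplified])
  \<comment> \<open>Otherwise \<open>p\<close> would divide \<open>v\<close> as well, and p^2 would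
    divide k p although k <= 2 < p.\<close>
  have pu: "\<not> int p dvd u"
  proof
    assume u: "int p dvd u"
    moreover have "5 * v\<^sup>2 = int k * int p - u\<^sup>2" using uv by simp
    moreover have "int p dvd int k * int p - u\<^sup>2"
      using u by (intro dvd_diff) (simp_all add: power2_eq_square)
    ultimately have "int p dvd 5 * v\<^sup>2" by simp
    then have "int p dvd v" using prime_dvd_mult_iff[OF pp] prime_dvd_power[OF pp] p10 by blast
    with u obtain a b where "u = int p * a" "v = int p * b" by (auto elim!: dvdE)
    with uv have "int p * int k = int p * (int p * (a\<^sup>2 + 5 * b\<^sup>2))"
      by (simp add: power2_eq_square algebra_simps)
    then have "int k = int p * (a\<^sup>2 + 5 * b\<^sup>2)" using p by simp
    then have "int p dvd int k" by simp
    then have "p \<le> k" using k by (auto dest: dvd_imp_le)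
    with k p show False by auto
  qed
  have un: "sols (p * m) = ?A v \<union> ?B"
  proof -
    have *: "int p dvd y * u - x * v \<or> int p dvd y * u + x * v" if "x\<^sup>2 + 5 * y\<^sup>2 = int p * int m" for x y
    proof -
      have "(y * u - x * v) * (y * u + x * v) = y\<^sup>2 * (u\<^sup>2 + 5 * v\<^sup>2) - v\<^sup>2 * (x\<^sup>2 + 5 * y\<^sup>2)"
        by (simp add: power2_eq_square algebra_simps)
      also have "int p dvd \<dots>" unfolding uv that by simp
      finally show ?thesis by (simp only: prime_dvd_mult_iff[OF pp])
    qed
    have "z \<in> ?A v \<union> ?B" if "z \<in> sols (p * m)" for z
      using that *[of "fst z" "snd z"] by (cases z) auto
    then show ?thesis by auto
  qed
  have Int: "?A v \<inter> ?B = {(x, y) \<in> sols (p * m). int p dvd x \<and> int p dvd y}"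
  proof -
    have "int p dvd x \<and> int p dvd y" if xy: "x\<^sup>2 + 5 * y\<^sup>2 = int p * int m"
      and d: "int p dvd y * u - x * v" "int p dvd y * u + x * v" for x y
    proof -
      have "2 * (y * u) = (y * u - x * v) + (y * u + x * v)" by simp
      then have "int p dvd 2 * (y * u)" using dvd_add[OF d] by (simp only:)
      then have y: "int p dvd y" using p10 pu by (simp add: prime_dvd_mult_iff[OF pp])
      then have "int p dvd int p * int m - 5 * y\<^sup>2" by (simp add: power2_eq_square)
      moreover have "x\<^sup>2 = int p * int m - 5 * y\<^sup>2" using xy by simp
      ultimately have "int p dvd x\<^sup>2" by simp
      with y show ?thesis using prime_dvd_power[OF pp] by blast
    qed
    then show ?thesis by auto
  qed
  have "card (?A v \<inter> ?B) = (if p dvd m then card (sols (m div p)) else 0)"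
  proof (cases "p dvd m")
    case True
    then obtain l where "m = p * l" by (rule dvdE)
    then show ?thesis
      unfolding Int using card_sols_common_divisor[of p l] p by (simp add: power2_eq_square mult.assoc)
  next
    case False
    have "\<not> (int p dvd x \<and> int p dvd y)" if xy: "x\<^sup>2 + 5 * y\<^sup>2 = int p * int m" for x y
    proof
      assume "int p dvd x \<and> int p dvd y"
      then obtain a b where "x = int p * a" "y = int p * b" by (auto elim!: dvdE)
      with xy have "int p * int m = int p * (int p * (a\<^sup>2 + 5 * b\<^sup>2))"
        by (simp add: power2_eq_square algebra_simps)
      then have "int m = int p * (a\<^sup>2 + 5 * b\<^sup>2)" using p by simp
      then have "int p dvd int m" by simp
      with False show False by simp
    qed
    then have "{(x, y) \<in> sols (p * m). int p dvd x \<and> int p dvd y} = {}" by auto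
    from arg_cong[OF this, of card] False show ?thesis unfolding Int by (simp only: card.empty if_False)
  qed
  moreover have "card (?A v) = card (sols (k * m))"
    using card_sols_half[OF p(1) k uv] .
  \<comment> \<open>Conjugating pi, that is replacing \<open>v\<close> by \<open>-v\<close>, reduces
    this to the previous count.\<close>
  moreover have "card ?B = card (sols (k * m))"
    using card_sols_half[OF p(1) k, of u "- v" m] uv
    by (simp only: mult_minus_right minus_diff_eq diff_minus_eq_add power2_minus)
  moreover have "finite (?A v)" "finite ?B"
    by (rule finite_subset[OF _ finite_sols[of "p * m"]]; auto)+
  ultimately show ?thesis
    using card_Un_Int[of "?A v" ?B] arg_cong[OF un, of card] by linarith
qed

section \<open>The product formula\<close>

lemma multiplicity_times_prime:
  fixes p q m :: nat
  assumes "prime p" "prime q" "m > 0"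
  shows "multiplicity q (p * m) = of_bool (p = q) + multiplicity q m"
  using assms by (simp add: prime_elem_multiplicity_mult_distrib prime_multiplicity_other)

lemma num_prime_factors_mod_times_prime:
  assumes "prime p" "m > 0"
  shows "num_prime_factors_mod d R (p * m) = of_bool (p mod d \<in> R) + num_prime_factors_mod d R m"
  using assms by (simp add: num_prime_factors_mod_def prime_factorization_times_prime)

text \<open>For a prime \<open>p\<close>, this is the number of ideals of norm p^v in Z[sqrt(-5)]: 2
  and 5 ramify, the classes 1, 3, 7, 9 modulo 20 split, the other primes are inert. The prime 3
  counts as split here, whereas \<open>Lambda\<close> leaves it out.\<close>

definition local_factor :: "nat \<Rightarrow> nat \<Rightarrow> real" where
  "local_factor p v =
     (if p \<in> {2, 5} then 1 else if p mod 20 \<in> {1, 3, 7, 9} then 1 + real v else (1 + (-1) ^ v) / 2)"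

text \<open>Isolating one prime lets an induction step from \<open>m\<close> to \<open>p * m\<close>
  change a single exponent.\<close>

definition cofactor :: "nat \<Rightarrow> nat \<Rightarrow> real" where
  "cofactor p n = (\<Prod>q\<in>prime_factors n - {p}. local_factor q (multiplicity q n))"

definition full_factor :: "nat \<Rightarrow> real" where
  "full_factor n = (\<Prod>q\<in>prime_factors n. local_factor q (multiplicity q n))"

lemma local_factor_0 [simp]: "local_factor p 0 = 1"
  by (simp add: local_factor_def)

lemma full_factor_split:
  assumes "prime p" "n > 0"
  shows "full_factor n = local_factor p (multiplicity p n) * cofactor p n"
proof (cases "p \<in> prime_factors n")
  case True
  then show ?thesis
    unfolding full_factor_def cofactor_def by (intro prod.remove) auto
next
  case False
  with assms have "multiplicity p n = 0"
    by (simp add: prime_factors_multiplicity)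
  with False show ?thesis
    by (simp add: full_factor_def cofactor_def)
qed

lemma cofactor_times_prime:
  assumes "prime p" "m > 0"
  shows "cofactor p (p * m) = cofactor p m"
  unfolding cofactor_def
proof (rule prod.cong)
  show "prime_factors (p * m) - {p} = prime_factors m - {p}"
    using assms by (auto simp: prime_factorization_times_prime)
  show "local_factor q (multiplicity q (p * m)) = local_factor q (multiplicity q m)"
    if "q \<in> prime_factors m - {p}" for q
    using that assms by (auto simp: multiplicity_times_prime in_prime_factors_imp_prime)
qed

lemma prime_mod_20:
  fixes p :: nat
  assumes "prime p" "p \<noteq> 2" "p \<noteq> 5"
  shows "p mod 20 \<in> {1, 3, 7, 9} \<union> {11, 13, 17, 19}"
proof -
  define r where "r = p mod 20"
  have "odd p" "\<not> 5 dvd p"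
    using assms primes_dvd_imp_eq[of 5 p] primes_dvd_imp_eq[of 2 p] by auto
  then have "r mod 2 \<noteq> 0" "r mod 5 \<noteq> 0"
    unfolding r_def by (simp_all add: mod_mod_cancel dvd_eq_mod_eq_0)
  moreover have "r \<in> set [0..<20]" by (simp add: r_def)
  ultimately show ?thesis
    unfolding r_def[symmetric] by (auto simp: upt_rec)
qed

text \<open>\<open>Lambda\<close> skips 2, 5 and 3. The first two have local factor 1, so only the
  factor of 3 has to be restored.\<close>

lemma full_factor_eq_Lambda:
  assumes "n > 0"
  shows "full_factor n = (1 + real (multiplicity 3 n)) * Lambda n"
proof -
  let ?S = "prime_factors n" and ?v = "\<lambda>p. multiplicity p n"
  \<comment> \<open>The filtered products in \<open>Lambda\<close> become products over all prime
    factors, with value 1 outside the filter; \<open>?h\<close> singles out the prime 3.\<close>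
  let ?f = "\<lambda>p. if 3 < p \<and> p mod 20 \<in> {1, 3, 7, 9} then 1 + real (?v p) else 1"
  let ?g = "\<lambda>p. if p mod 20 \<in> {11, 13, 17, 19} then (1 + (-1) ^ ?v p) / 2 else (1 :: real)"
  let ?h = "\<lambda>p. if p = 3 then 1 + real (?v 3) else 1"
  have "local_factor p (?v p) = ?h p * (?f p * ?g p)" if "p \<in> ?S" for p
  proof -
    have p: "prime p" using that by auto
    then have "p = 2 \<or> p = 5 \<or> p = 3 \<or> (p > 3 \<and> p \<noteq> 5 \<and> p mod 20 \<in> {1, 3, 7, 9} \<union> {11, 13, 17, 19})"
      using prime_mod_20[OF p] prime_ge_2_nat[OF p] by auto
    then show ?thesis
      by (elim disjE conjE UnE) (simp_all add: local_factor_def, auto)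
  qed
  then have "full_factor n = (\<Prod>p\<in>?S. ?h p * (?f p * ?g p))"
    unfolding full_factor_def by (intro prod.cong) auto
  also have "\<dots> = (\<Prod>p\<in>?S. ?h p) * ((\<Prod>p\<in>?S. ?f p) * (\<Prod>p\<in>?S. ?g p))"
    by (simp only: prod.distrib)
  also have "(\<Prod>p\<in>?S. ?h p) = 1 + real (?v 3)"
    by (subst prod.delta[OF finite_set_mset]) (auto simp: prime_factors_multiplicity)
  also have "(\<Prod>p\<in>?S. ?f p) * (\<Prod>p\<in>?S. ?g p) = Lambda n"
    unfolding Lambda_def by (simp only: prod.inter_filter finite_set_mset)
  finally show ?thesis .
qed

text \<open>Makes visible that \<open>Lambda\<close> ignores the power of 3 in its argument; this
  serves to compare n with n/9.\<close>

lemma Lambda_eq_cofactor: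
  assumes "n > 0"
  shows "Lambda n = cofactor 3 n"
proof -
  have "(1 + real (multiplicity 3 n)) * Lambda n = local_factor 3 (multiplicity 3 n) * cofactor 3 n"
    using full_factor_split[of 3 n] full_factor_eq_Lambda[of n] assms by simp
  then show ?thesis by (simp add: local_factor_def)
qed

text \<open>Completely multiplicative in \<open>n\<close>, with value -1 at exactly those primes
  that lie below a non-principal prime ideal of Z[sqrt(-5)].\<close>

definition genus_sign :: "nat \<Rightarrow> real" where
  "genus_sign n = (-1) ^ (multiplicity 2 n + num_prime_factors_mod 20 {3, 7} n)"

lemma genus_sign_times_prime:
  assumes "prime p" "m > 0"
  shows "genus_sign (p * m) = (if p = 2 \<or> p mod 20 \<in> {3, 7} then -1 else 1) * genus_sign m"
  using assms
  by (auto simp: genus_sign_def multiplicity_times_prime num_prime_factors_mod_times_prime)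

text \<open>Among 2, 5 and the split primes other than 3, the sign -1 falls exactly on those that
  are 2 modulo 3. Inert primes get the sign 1 whatever their residue.\<close>

definition sign_mod_3 :: "nat \<Rightarrow> real" where
  "sign_mod_3 n = (-1) ^ (multiplicity 2 n + multiplicity 5 n + num_prime_factors_mod 60 {23, 29, 41, 47} n)"

lemma sign_mod_3_times_prime:
  assumes "prime p" "m > 0"
  shows "sign_mod_3 (p * m) =
    (if p = 2 \<or> p = 5 \<or> p mod 60 \<in> {23, 29, 41, 47} then -1 else 1) * sign_mod_3 m"
  using assms
  by (auto simp: sign_mod_3_def multiplicity_times_prime num_prime_factors_mod_times_prime)

section \<open>Counting the solutions for n and 2n\<close>

lemma card_sols_1: "card (sols 1) = 2"
  and card_sols_2: "card (sols 2) = 0"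
proof -
  have y: "y = 0" if "x\<^sup>2 + 5 * y\<^sup>2 < 5" for x y :: int
  proof (rule ccontr)
    assume "y \<noteq> 0"
    then have "y\<^sup>2 \<ge> 1" using zero_less_power2[of y] by linarith
    with that zero_le_power2[of x] show False by linarith
  qed
  have x: "x\<^sup>2 \<noteq> 2" for x :: int
  proof
    assume x: "x\<^sup>2 = 2"
    then have "even (x\<^sup>2)" by simp
    then have "even x" by simp
    then obtain z where "x = 2 * z" by (rule evenE)
    with x have "4 * z\<^sup>2 = 2" by (simp add: power2_eq_square)
    then show False by presburger
  qed
  have "(x, y) \<notin> sols 2" for x y
    using x[of x] y[of x y] by (cases "y = 0") auto
  then have "sols 2 = {}" by auto
  then show "card (sols 2) = 0" by simp
  have "(x, y) \<in> sols 1 \<longleftrightarrow> (x, y) \<in> {(1, 0), (-1, 0)}" for x y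
    using y[of x y] by (cases "y = 0") (auto simp: power2_eq_1_iff)
  then have "sols 1 = {(1, 0), (-1, 0)}" by auto
  then show "card (sols 1) = 2" by simp
qed

text \<open>The ideals of norm \<open>n\<close> in Z[sqrt(-5)] all lie in the class given by
  \<open>genus_sign n\<close>, and a principal one has two generators; passing to
  \<open>2 * n\<close> switches the class. The two counts are proved together because
  \<open>p = 2\<close> and the multiplier k = 2 interchange them.\<close>

lemma card_sols_formula:
  assumes "n > 0"
  shows "real (card (sols n)) = (1 + genus_sign n) * full_factor n
       \<and> real (card (sols (2 * n))) = (1 - genus_sign n) * full_factor n"
  using assms
proof (induction n rule: less_induct)
  case (less n)
  show ?case
  proof (cases "n = 1")
    case True
    then show ?thesis
      using card_sols_1 card_sols_2
      by (simp add: genus_sign_def full_factor_def num_prime_factors_mod_def)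
  next
    case False
    then obtain p where p: "prime p" "p dvd n"
      using prime_factor_nat by blast
    then obtain m where n: "n = p * m" by (auto elim: dvdE)
    with less.prems have m: "m > 0" by simp
    define v H where "v = multiplicity p m" and "H = cofactor p m"
    have Gm: "full_factor m = local_factor p v * H"
      using full_factor_split[OF p(1) m] by (simp add: v_def H_def)
    have Gn: "full_factor n = local_factor p (Suc v) * H"
      using full_factor_split[OF p(1), of n] p(1) m prime_gt_0_nat[OF p(1)]
      by (simp add: n v_def H_def cofactor_times_prime multiplicity_times_prime)
    have Gl: "v > 0" "full_factor l = local_factor p (v - 1) * H" if "m = p * l" for l
      using full_factor_split[OF p(1), of l] p(1) m that
      by (simp_all add: v_def H_def cofactor_times_prime multiplicity_times_prime)
    have IHm: "real (card (sols m)) = (1 + genus_sign m) * full_factor m"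
      "real (card (sols (2 * m))) = (1 - genus_sign m) * full_factor m"
      using less.IH[of m] m prime_gt_1_nat[OF p(1)] by (simp_all add: n)
    have IHl: "l > 0" "real (card (sols l)) = (1 + genus_sign l) * full_factor l"
      "real (card (sols (2 * l))) = (1 - genus_sign l) * full_factor l" if "m = p * l" for l
    proof -
      show "l > 0" using m that by simp
      then have "l < n"
        using prime_gt_1_nat[OF p(1)] n_less_m_mult_n[of l p] n_less_m_mult_n[of m p] m
        unfolding n that by linarith
      with \<open>l > 0\<close> show "real (card (sols l)) = (1 + genus_sign l) * full_factor l"
        "real (card (sols (2 * l))) = (1 - genus_sign l) * full_factor l"
        using less.IH[of l] by simp_all
    qed
    note sgn_n = genus_sign_times_prime[OF p(1) m, folded n]
    consider (two) "p = 2" | (five) "p = 5"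
      | (split) "2 < p" "p \<noteq> 5" "p mod 20 \<in> {1, 3, 7, 9}"
      | (inert) "2 < p" "p \<noteq> 5" "p mod 20 \<notin> {1, 3, 7, 9}"
      using prime_ge_2_nat[OF p(1)] by linarith
    then show ?thesis
    proof cases
      case two
      then have "full_factor n = full_factor m" using Gm Gn by (simp add: local_factor_def)
      \<comment> \<open>R(n) = R(2m) and R(2n) = R(4m) = R(m): the counts trade places, matching the
        change of sign.\<close>
      then show ?thesis using IHm sgn_n two card_sols_four_times[of m] by (simp add: n)
    next
      case five
      then have "full_factor n = full_factor m" using Gm Gn by (simp add: local_factor_def)
      then show ?thesis
        using IHm sgn_n five card_sols_five_times[of m] card_sols_five_times[of "2 * m"]
        by (simp add: n mult.left_commute)
    next
      case split
      obtain u v' :: int and k :: nat where k: "k \<in> {1, 2}" and uv: "u\<^sup>2 + 5 * v'\<^sup>2 = int k * int p"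
        using prime_or_double_prime_form[OF p(1) split(1,3)] by (metis of_nat_mult)
      define e where "e = genus_sign m"
      define s :: real where "s = (if k = 1 then 1 else -1)"
      have "k = 1 \<longleftrightarrow> p mod 20 \<notin> {3, 7}"
        using form_multiplier_eq_1_iff[OF split(3) k uv] .
      then have s: "(if p = 2 \<or> p mod 20 \<in> {3, 7} then -1 else 1) = s"
        using split(1) by (auto simp: s_def)
      have ss: "s * s = 1" by (simp add: s_def)
      have lf: "local_factor p w = 1 + real w" for w
        using split by (simp add: local_factor_def)
      \<comment> \<open>If \<open>p\<close> does not divide \<open>m\<close>, then
        \<open>v = 0\<close>, so the right-hand sides also cover the absent term R(m/p).\<close>
      have D: "real (if p dvd m then card (sols (m div p)) else 0) = (1 + s * e) * (real v * H)
        \<and> real (if p dvd 2 * m then card (sols (2 * m div p)) else 0) = (1 - s * e) * (real v * H)"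
      proof (cases "p dvd m")
        case True
        then obtain l where l: "m = p * l" by (rule dvdE)
        have "e = s * genus_sign l"
          using genus_sign_times_prime[OF p(1) IHl(1)[OF l]] unfolding s e_def l .
        then have "s * e = genus_sign l" using ss by (simp flip: mult.assoc)
        moreover have "full_factor l = real v * H"
          using Gl[OF l] by (simp add: lf)
        moreover have "m div p = l" "2 * m div p = 2 * l"
          using p(1) by (simp_all add: l mult.left_commute)
        ultimately show ?thesis using True IHl[OF l] by simp
      next
        case False
        then have "v = 0" by (simp add: v_def not_dvd_imp_multiplicity_0)
        moreover have "\<not> p dvd 2 * m"
          using False p(1) split primes_dvd_imp_eq[of p 2] by (auto simp: prime_dvd_mult_iff)
        ultimately show ?thesis using False by simp
      qed
      have S: "real (card (sols n)) + (1 + s * e) * (real v * H) = 2 * real (card (sols (k * m)))"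
        "real (card (sols (2 * n))) + (1 - s * e) * (real v * H) = 2 * real (card (sols (k * (2 * m))))"
        using arg_cong[OF card_sols_split_prime[OF p(1) split(1,2) k uv, of m], of real]
          arg_cong[OF card_sols_split_prime[OF p(1) split(1,2) k uv, of "2 * m"], of real] D
        by (simp_all only: of_nat_add of_nat_mult of_nat_numeral n mult.left_commute[of p 2 m])
      \<comment> \<open>A multiplier \<open>k = 2\<close> swaps the counts for \<open>m\<close> and
        \<open>2 * m\<close>, and \<open>s\<close> is -1 in that case, so one formula covers both
        multipliers.\<close>
      have K: "real (card (sols (k * m))) = (1 + s * e) * ((1 + real v) * H)"
        "real (card (sols (k * (2 * m)))) = (1 - s * e) * ((1 + real v) * H)"
        using k IHm card_sols_four_times[of m] by (auto simp: s_def e_def Gm lf)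
      have "genus_sign n = s * e" using sgn_n unfolding s e_def .
      \<comment> \<open>The local factors combine as 2(1 + v) - v = 2 + v, which is the value at
        \<open>Suc v\<close>.\<close>
      then show ?thesis
        using S K by (simp add: Gn lf algebra_simps)
    next
      case inert
      have lf: "local_factor p w = (1 + (-1) ^ w) / 2" for w
        using inert by (simp add: local_factor_def)
      show ?thesis
      proof (cases "p dvd m")
        case True
        then obtain l where l: "m = p * l" by (rule dvdE)
        have "p mod 20 \<notin> {3, 7}" using inert by auto
        then have "genus_sign n = genus_sign l"
          using sgn_n genus_sign_times_prime[OF p(1) IHl(1)[OF l]] l inert by simp
        moreover have "full_factor n = full_factor l"
          using Gl[OF l] Gn by (cases v) (simp_all add: lf)
        moreover have "card (sols n) = card (sols l)" "card (sols (2 * n)) = card (sols (2 * l))"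
          using card_sols_inert_square[OF p(1) inert, of l] card_sols_inert_square[OF p(1) inert, of "2 * l"]
          by (simp_all add: n l power2_eq_square mult_ac)
        ultimately show ?thesis using IHl[OF l] by simp
      next
        case False
        \<comment> \<open>The exponent of \<open>p\<close> in \<open>n\<close> is now 1, where the
          local factor vanishes; there are no solutions for \<open>n\<close> or \<open>2 * n\<close>
          either.\<close>
        then have "v = 0" by (simp add: v_def not_dvd_imp_multiplicity_0)
        then have "full_factor n = 0" using Gn by (simp add: lf)
        moreover have "\<not> p dvd 2 * m"
          using False p(1) inert primes_dvd_imp_eq[of p 2] by (auto simp: prime_dvd_mult_iff)
        ultimately show ?thesis
          using sols_inert_empty[OF p(1) inert False] sols_inert_empty[OF p(1) inert, of "2 * m"]
          by (simp add: n mult.left_commute)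
      qed
    qed
  qed
qed

text \<open>A nonzero \<open>full_factor\<close> means that every inert prime occurs to an even
  power, so it contributes a square, which is 1 modulo 3. The other primes carry the right sign one
  by one.\<close>

lemma sign_mod_3_eq:
  assumes "n > 0" "\<not> 3 dvd n" "full_factor n \<noteq> 0"
  shows "sign_mod_3 n = (if n mod 3 = 1 then 1 else -1)"
  using assms
proof (induction n rule: less_induct)
  case (less n)
  let ?\<chi> = "\<lambda>n :: nat. if n mod 3 = 1 then 1 else -1 :: real"
  have \<chi>_mult: "?\<chi> (i * j) = ?\<chi> i * ?\<chi> j" if "\<not> 3 dvd i" "\<not> 3 dvd j" for i j
  proof -
    have "i mod 3 = 1 \<or> i mod 3 = 2" "j mod 3 = 1 \<or> j mod 3 = 2"
      using that by - presburger+
    moreover have "i * j mod 3 = (i mod 3) * (j mod 3) mod 3" by (simp add: mod_mult_eq)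
    ultimately show ?thesis by (elim disjE) simp_all
  qed
  show ?case
  proof (cases "n = 1")
    case True
    then show ?thesis by (simp add: sign_mod_3_def num_prime_factors_mod_def)
  next
    case False
    then obtain p where p: "prime p" "p dvd n"
      using prime_factor_nat by blast
    then obtain m where n: "n = p * m" by (auto elim: dvdE)
    with less.prems have m: "m > 0" by simp
    have p3: "\<not> 3 dvd p" "\<not> 3 dvd m" using less.prems(2) by (auto simp: n)
    define v H where "v = multiplicity p m" and "H = cofactor p m"
    have Gm: "full_factor m = local_factor p v * H"
      using full_factor_split[OF p(1) m] by (simp add: v_def H_def)
    have Gn: "full_factor n = local_factor p (Suc v) * H"
      using full_factor_split[OF p(1), of n] p(1) m prime_gt_0_nat[OF p(1)]
      by (simp add: n v_def H_def cofactor_times_prime multiplicity_times_prime)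
    with less.prems(3) have nz: "local_factor p (Suc v) \<noteq> 0" "H \<noteq> 0" by auto
    show ?thesis
    proof (cases "p = 2 \<or> p = 5 \<or> p mod 20 \<in> {1, 3, 7, 9}")
      case True
      then have "local_factor p v \<noteq> 0" by (auto simp: local_factor_def)
      with nz have "full_factor m \<noteq> 0" by (simp add: Gm)
      then have IH: "sign_mod_3 m = ?\<chi> m"
        using less.IH[of m] m p3 prime_gt_1_nat[OF p(1)] by (simp add: n)
      have "(if p = 2 \<or> p = 5 \<or> p mod 60 \<in> {23, 29, 41, 47} then -1 else 1) = ?\<chi> p"
      proof (cases "p = 2 \<or> p = 5")
        case False
        define r where "r = p mod 60"
        have eqs: "p mod 20 = r mod 20" "p mod 3 = r mod 3"
          unfolding r_def by (simp_all add: mod_mod_cancel)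
        have "r \<in> set [0..<60]" by (simp add: r_def)
        moreover have "r mod 20 \<in> {1, 3, 7, 9}" "r mod 3 \<noteq> 0"
          using True False p3(1) unfolding eqs[symmetric] by (auto simp: dvd_eq_mod_eq_0)
        ultimately have "r \<in> {1, 7, 23, 29, 41, 43, 47, 49}"
          by (auto simp: upt_rec)
        with False show ?thesis unfolding r_def[symmetric] eqs by auto
      qed auto
      then show ?thesis
        using sign_mod_3_times_prime[OF p(1) m] \<chi>_mult[OF p3] IH by (simp only: n)
    next
      case False
      then have lf: "local_factor p w = (1 + (-1) ^ w) / 2" for w
        by (simp add: local_factor_def)
      \<comment> \<open>\<open>local_factor p (Suc v)\<close> is nonzero only for odd
        \<open>v\<close>, so a second factor \<open>p\<close> can be removed.\<close>
      have "v \<noteq> 0" using nz(1) by (intro notI) (simp add: lf)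
      then have "p dvd m" by (metis v_def not_dvd_imp_multiplicity_0)
      then obtain l where l: "m = p * l" by (rule dvdE)
      with m have l0: "l > 0" by simp
      have "full_factor l = local_factor p (v - 1) * H" 
        using full_factor_split[OF p(1) l0] p(1) l0
        by (simp add: v_def H_def l cofactor_times_prime multiplicity_times_prime)
      moreover have "local_factor p (v - 1) = local_factor p (Suc v)"
        using \<open>v \<noteq> 0\<close> by (cases v) (simp_all add: lf)
      ultimately have "full_factor l \<noteq> 0" using nz by simp
      moreover have "l < n"
        using prime_gt_1_nat[OF p(1)] n_less_m_mult_n[of l p] n_less_m_mult_n[of m p] m l0
        unfolding n l by linarith
      moreover have l3: "\<not> 3 dvd l" using p3(2) by (auto simp: l)
      ultimately have IH: "sign_mod_3 l = ?\<chi> l"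
        using less.IH[of l] l0 by simp
      have "sign_mod_3 n = sign_mod_3 l"
        unfolding n l sign_mod_3_times_prime[OF p(1) m, unfolded l] sign_mod_3_times_prime[OF p(1) l0]
        by simp
      moreover have "?\<chi> n = ?\<chi> l"
        unfolding n \<chi>_mult[OF p3] unfolding l \<chi>_mult[OF p3(1) l3] by simp
      ultimately show ?thesis using IH by simp
    qed
  qed
qed

text \<open>Every class modulo 60 prime to 3 lies in none or in exactly two of the three residue
  sets. This makes the third sign of the theorem the product of the other two.\<close>

lemma num_prime_factors_mod_parity:
  assumes "\<not> 3 dvd n"
  shows "even (num_prime_factors_mod 20 {3, 7} n + num_prime_factors_mod 60 {23, 29, 41, 47} n
    + num_prime_factors_mod 60 {7, 29, 41, 43} n)"
proof -
  have "even (size {#p \<in># M. p mod 20 \<in> {3, 7}#} + size {#p \<in># M. p mod 60 \<in> {23, 29, 41, 47}#}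
      + size {#p \<in># M. p mod 60 \<in> {7, 29, 41, 43}#})" if "\<forall>p\<in>#M. \<not> 3 dvd p" for M :: "nat multiset"
    using that
  proof (induction M)
    case (add p M)
    define r where "r = p mod 60"
    have eqs: "p mod 20 = r mod 20" "p mod 3 = r mod 3"
      unfolding r_def by (simp_all add: mod_mod_cancel)
    have "r mod 3 \<noteq> 0"
      using add.prems unfolding eqs[symmetric] by (auto simp: dvd_eq_mod_eq_0)
    moreover have "r \<in> set [0..<60]" by (simp add: r_def)
    ultimately have "even (of_bool (p mod 20 \<in> {3, 7}) + of_bool (p mod 60 \<in> {23, 29, 41, 47})
        + (of_bool (p mod 60 \<in> {7, 29, 41, 43}) :: nat))"
      unfolding eqs r_def[symmetric] by (auto simp: upt_rec)
    moreover have "size {#q \<in># add_mset p M. P q#} = of_bool (P p) + size {#q \<in># M. P q#}" for P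
      by simp
    moreover have "even (size {#p \<in># M. p mod 20 \<in> {3, 7}#} + size {#p \<in># M. p mod 60 \<in> {23, 29, 41, 47}#}
      + size {#p \<in># M. p mod 60 \<in> {7, 29, 41, 43}#})"
      using add by simp
    ultimately show ?case
      by (simp only: even_add) argo
  qed simp
  moreover have "\<forall>p\<in>#prime_factorization n. \<not> 3 dvd p"
    using assms by (auto dest: in_prime_factors_imp_dvd dvd_trans)
  ultimately show ?thesis by (simp only: num_prime_factors_mod_def)
qed

section \<open>Forms of discriminant -180\<close>

lemma square_mod_3: "(x :: int)\<^sup>2 mod 3 = of_bool (\<not> 3 dvd x)"
proof -
  have "x mod 3 \<in> {0, 1, 2}" by auto
  then have "(x mod 3)\<^sup>2 mod 3 = of_bool (x mod 3 \<noteq> 0)" by auto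
  then show ?thesis by (simp add: power_mod dvd_eq_mod_eq_0)
qed

text \<open>Modulo 3 the form is x^2 - y^2, and squares are 0 or 1.\<close>

lemma sols_mod_3:
  assumes "(x, y) \<in> sols N"
  shows "N mod 3 = 1 \<Longrightarrow> \<not> 3 dvd x \<and> 3 dvd y"
    and "N mod 3 = 2 \<Longrightarrow> 3 dvd x \<and> \<not> 3 dvd y"
    and "N mod 3 = 0 \<Longrightarrow> 3 dvd x \<longleftrightarrow> 3 dvd y"
proof -
  have "int N mod 3 = (x\<^sup>2 + 5 * y\<^sup>2) mod 3" using assms by simp
  also have "\<dots> = (x\<^sup>2 mod 3 + 5 * (y\<^sup>2 mod 3)) mod 3"
    by (intro mod_add_cong mod_mult_cong) simp_all
  finally have "int (N mod 3) = (of_bool (\<not> 3 dvd x) + 5 * of_bool (\<not> 3 dvd y)) mod 3"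
    by (simp only: zmod_int square_mod_3 of_nat_numeral)
  then show "N mod 3 = 1 \<Longrightarrow> \<not> 3 dvd x \<and> 3 dvd y"
    and "N mod 3 = 2 \<Longrightarrow> 3 dvd x \<and> \<not> 3 dvd y"
    and "N mod 3 = 0 \<Longrightarrow> 3 dvd x \<longleftrightarrow> 3 dvd y"
    by (cases "3 dvd x"; cases "3 dvd y"; simp)+
qed

section \<open>Solutions with a coordinate divisible by 3, and the four forms\<close>

definition sols_fst3 :: "nat \<Rightarrow> (int \<times> int) set" where
  "sols_fst3 N = {(x, y) \<in> sols N. 3 dvd x}"

definition sols_snd3 :: "nat \<Rightarrow> (int \<times> int) set" where
  "sols_snd3 N = {(x, y) \<in> sols N. 3 dvd y}"

lemma sols_3_mod_1:
  assumes "N mod 3 = 1"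
  shows "sols_fst3 N = {}" "sols_snd3 N = sols N"
  using sols_mod_3(1)[OF _ assms] by (auto simp: sols_fst3_def sols_snd3_def simp del: in_sols)

lemma sols_3_mod_2:
  assumes "N mod 3 = 2"
  shows "sols_fst3 N = sols N" "sols_snd3 N = {}"
  using sols_mod_3(2)[OF _ assms] by (auto simp: sols_fst3_def sols_snd3_def simp del: in_sols)

lemma sols_3_dvd:
  assumes "3 dvd N"
  shows "sols_fst3 N = {(x, y) \<in> sols N. 3 dvd x \<and> 3 dvd y}" "sols_snd3 N = sols_fst3 N"
proof -
  have "N mod 3 = 0" using assms by simp
  then show "sols_fst3 N = {(x, y) \<in> sols N. 3 dvd x \<and> 3 dvd y}" "sols_snd3 N = sols_fst3 N"
    using sols_mod_3(3)[of _ _ N] by (auto simp: sols_fst3_def sols_snd3_def simp del: in_sols)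
qed

lemma card_sols_3_nine_times:
  "card (sols_fst3 (9 * l)) = card (sols l)" "card (sols_snd3 (9 * l)) = card (sols l)"
proof -
  show 1: "card (sols_fst3 (9 * l)) = card (sols l)"
    using card_sols_common_divisor[of 3 l] sols_3_dvd(1)[of "9 * l"]
    by (simp del: in_sols)
  then show "card (sols_snd3 (9 * l)) = card (sols l)"
    using sols_3_dvd(2)[of "9 * l"] by simp
qed

lemma sols_3_empty:
  assumes "3 dvd N" "\<not> 9 dvd N"
  shows "sols_fst3 N = {}" "sols_snd3 N = {}"
proof -
  have "False" if "(x, y) \<in> sols N" "3 dvd x" "3 dvd y" for x y
  proof -
    from that obtain a b where "x = 3 * a" "y = 3 * b" by (auto elim!: dvdE)
    with that(1) have "int N = 9 * (a\<^sup>2 + 5 * b\<^sup>2)" by (simp add: power2_eq_square)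
    then have "9 dvd int N" by simp
    then have "9 dvd N" by presburger
    with assms show False by simp
  qed
  then show "sols_fst3 N = {}" "sols_snd3 N = {}"
    using sols_3_dvd[OF assms(1)] by (auto simp del: in_sols)
qed

lemma form_reps_1_0_45: "form_reps 1 0 45 n = card (sols_snd3 n)"
proof -
  have "bij_betw (\<lambda>(x, y). (x, 3 * y))
    {(x, y). 1 * x\<^sup>2 + 0 * x * y + 45 * y\<^sup>2 = int n} (sols_snd3 n)"
    by (rule bij_betw_byWitness[where f' = "\<lambda>(x, y). (x, y div 3)"])
      (auto simp: sols_snd3_def power2_eq_square elim!: dvdE)
  then show ?thesis unfolding form_reps_def by (rule bij_betw_same_card)
qed

lemma form_reps_5_0_9: "form_reps 5 0 9 n = card (sols_fst3 n)"
proof -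
  have "bij_betw (\<lambda>(x, y). (3 * y, x))
    {(x, y). 5 * x\<^sup>2 + 0 * x * y + 9 * y\<^sup>2 = int n} (sols_fst3 n)"
    by (rule bij_betw_byWitness[where f' = "\<lambda>(x, y). (y, x div 3)"])
      (auto simp: sols_fst3_def power2_eq_square elim!: dvdE)
  then show ?thesis unfolding form_reps_def by (rule bij_betw_same_card)
qed

lemma even_sols_iff:
  assumes "(x, y) \<in> sols (2 * n)"
  shows "even x \<longleftrightarrow> even y"
proof -
  have "even (x\<^sup>2 + 5 * y\<^sup>2)" using assms by simp
  then show ?thesis by simp
qed

text \<open>Twice the form is (3(x + y))^2 + 5(x - y)^2.\<close>

lemma form_reps_7_4_7: "form_reps 7 4 7 n = card (sols_fst3 (2 * n))"
proof -
  let ?A = "{(x, y). 7 * x\<^sup>2 + 4 * x * y + 7 * y\<^sup>2 = int n}"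
  let ?f = "\<lambda>(x, y). (3 * (x + y), x - y) :: int \<times> int"
  have "bij_betw ?f ?A (sols_fst3 (2 * n))"
  proof (rule bij_betw_imageI)
    show "inj_on ?f ?A" by (auto simp: inj_on_def)
    have id: "(3 * (x + y))\<^sup>2 + 5 * (x - y)\<^sup>2 = 2 * (7 * x\<^sup>2 + 4 * x * y + 7 * y\<^sup>2)" for x y :: int
      by (simp add: power2_eq_square algebra_simps)
    show "?f ` ?A = sols_fst3 (2 * n)"
    proof
      show "?f ` ?A \<subseteq> sols_fst3 (2 * n)"
      proof (rule image_subsetI)
        fix z assume "z \<in> ?A"
        then obtain x y where z: "z = (x, y)" "(x, y) \<in> ?A" by (cases z) auto
        then have "(3 * (x + y))\<^sup>2 + 5 * (x - y)\<^sup>2 = 2 * int n" unfolding id by simp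
        then show "?f z \<in> sols_fst3 (2 * n)" by (simp add: z(1) sols_fst3_def)
      qed
      show "sols_fst3 (2 * n) \<subseteq> ?f ` ?A"
      proof clarify
        fix X Y assume "(X, Y) \<in> sols_fst3 (2 * n)"
        then have XY: "(X, Y) \<in> sols (2 * n)" and "3 dvd X" by (auto simp: sols_fst3_def)
        then obtain Z where Z: "X = 3 * Z" by (auto elim: dvdE)
        \<comment> \<open>Parity gives surjectivity: \<open>x\<close> is half of
          \<open>Z + Y\<close>, and the second coordinate of the preimage is
          \<open>x - Y\<close>.\<close>
        then have "even (Z + Y)" using even_sols_iff[OF XY] by simp
        then obtain x where "Z + Y = 2 * x" by (rule evenE)
        then have eq: "X = 3 * (x + (x - Y))" "Y = x - (x - Y)" using Z by simp_all
        have "2 * (7 * x\<^sup>2 + 4 * x * (x - Y) + 7 * (x - Y)\<^sup>2) = 2 * int n"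
          using XY unfolding id[symmetric] eq[symmetric] by simp
        then have "(x, x - Y) \<in> ?A" by simp
        then have "?f (x, x - Y) \<in> ?f ` ?A" by (rule imageI)
        then show "(X, Y) \<in> ?f ` ?A" using eq by simp
      qed
    qed
  qed
  then show ?thesis unfolding form_reps_def by (rule bij_betw_same_card)
qed

text \<open>Completing the square, twice the form is (2x + y)^2 + 5(3y)^2.\<close>

lemma form_reps_2_2_23: "form_reps 2 2 23 n = card (sols_snd3 (2 * n))"
proof -
  let ?A = "{(x, y). 2 * x\<^sup>2 + 2 * x * y + 23 * y\<^sup>2 = int n}"
  let ?f = "\<lambda>(x, y). (2 * x + y, 3 * y) :: int \<times> int"
  have "bij_betw ?f ?A (sols_snd3 (2 * n))"
  proof (rule bij_betw_imageI)
    show "inj_on ?f ?A" by (auto simp: inj_on_def)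
    have id: "(2 * x + y)\<^sup>2 + 5 * (3 * y)\<^sup>2 = 2 * (2 * x\<^sup>2 + 2 * x * y + 23 * y\<^sup>2)" for x y :: int
      by (simp add: power2_eq_square algebra_simps)
    show "?f ` ?A = sols_snd3 (2 * n)"
    proof
      show "?f ` ?A \<subseteq> sols_snd3 (2 * n)"
      proof (rule image_subsetI)
        fix z assume "z \<in> ?A"
        then obtain x y where z: "z = (x, y)" "(x, y) \<in> ?A" by (cases z) auto
        then have "(2 * x + y)\<^sup>2 + 5 * (3 * y)\<^sup>2 = 2 * int n" unfolding id by simp
        then show "?f z \<in> sols_snd3 (2 * n)" by (simp add: z(1) sols_snd3_def)
      qed
      show "sols_snd3 (2 * n) \<subseteq> ?f ` ?A"
      proof clarify
        fix X Y assume "(X, Y) \<in> sols_snd3 (2 * n)"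
        then have XY: "(X, Y) \<in> sols (2 * n)" and "3 dvd Y" by (auto simp: sols_snd3_def)
        then obtain y where y: "Y = 3 * y" by (auto elim: dvdE)
        then have "even (X - y)" using even_sols_iff[OF XY] by simp
        then obtain x where "X - y = 2 * x" by (rule evenE)
        then have eq: "X = 2 * x + y" by simp
        have "2 * (2 * x\<^sup>2 + 2 * x * y + 23 * y\<^sup>2) = 2 * int n"
          using XY unfolding id[symmetric] eq y by simp
        then have "(x, y) \<in> ?A" by simp
        then have "?f (x, y) \<in> ?f ` ?A" by (rule imageI)
        then show "(X, Y) \<in> ?f ` ?A" by (simp add: eq y)
      qed
    qed
  qed
  then show ?thesis unfolding form_reps_def by (rule bij_betw_same_card)
qed

theorem theorem4p3:
  fixes n a b c t1 t2 t3 :: nat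
  assumes "n > 0"
    and "a = multiplicity 2 n"
    and "b = multiplicity 3 n"
    and "c = multiplicity 5 n"
    and "t1 = num_prime_factors_mod 20 {3, 7} n"
    and "t2 = num_prime_factors_mod 60 {23, 29, 41, 47} n"
    and "t3 = num_prime_factors_mod 60 {7, 29, 41, 43} n"
  shows "real (form_reps 1 0 45 n) =
           (if b = 0 then 1/2 * (1 + (-1) ^ (a + t1) + (-1) ^ (a + c + t2) + (-1) ^ (c + t3)) * Lambda n
            else (real b - 1) * (1 + (-1) ^ (a + t1)) * Lambda n)
       \<and> real (form_reps 5 0 9 n) =
           (if b = 0 then 1/2 * (1 + (-1) ^ (a + t1) - (-1) ^ (a + c + t2) - (-1) ^ (c + t3)) * Lambda n
            else (real b - 1) * (1 + (-1) ^ (a + t1)) * Lambda n)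
       \<and> real (form_reps 7 4 7 n) =
           (if b = 0 then 1/2 * (1 - (-1) ^ (a + t1) + (-1) ^ (a + c + t2) - (-1) ^ (c + t3)) * Lambda n
            else (real b - 1) * (1 - (-1) ^ (a + t1)) * Lambda n)
       \<and> real (form_reps 2 2 23 n) =
           (if b = 0 then 1/2 * (1 - (-1) ^ (a + t1) - (-1) ^ (a + c + t2) + (-1) ^ (c + t3)) * Lambda n
            else (real b - 1) * (1 - (-1) ^ (a + t1)) * Lambda n)"
proof -
  have e: "(-1) ^ (a + t1) = genus_sign n"
    using assms by (simp add: genus_sign_def)
  show ?thesis
  proof (cases "b = 0")
    case True
    then have n3: "\<not> 3 dvd n"
      using assms(1,3) by (auto simp: multiplicity_eq_zero_iff)
    have G: "full_factor n = Lambda n"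
      using full_factor_eq_Lambda[OF assms(1)] True assms(3) by simp
    have card: "real (card (sols n)) = (1 + genus_sign n) * Lambda n"
      "real (card (sols (2 * n))) = (1 - genus_sign n) * Lambda n"
      using card_sols_formula[OF assms(1)] G by simp_all
    define \<tau> where "\<tau> = sign_mod_3 n"
    have \<tau>: "(-1) ^ (a + c + t2) = \<tau>"
      using assms by (simp add: sign_mod_3_def \<tau>_def)
    have "even (t1 + t2 + t3)"
      using num_prime_factors_mod_parity[OF n3] assms by simp
    \<comment> \<open>The two copies of \<open>a\<close> cancel modulo 2, so the third sign is the
      product of the first two.\<close>
    then have "even (c + t3) \<longleftrightarrow> even ((a + t1) + (a + c + t2))" by auto
    then have "(-1) ^ (c + t3) = ((-1) ^ ((a + t1) + (a + c + t2)) :: real)"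
      by (simp only: minus_one_power_iff)
    also have "\<dots> = genus_sign n * \<tau>"
      by (simp only: power_add[of _ "a + t1"] e \<tau>)
    finally have e\<tau>: "(-1) ^ (c + t3) = genus_sign n * \<tau>" .
    \<comment> \<open>The sign is determined only for nonzero \<open>Lambda n\<close>; if
      \<open>Lambda n = 0\<close>, all counts and right-hand sides vanish.\<close>
    have \<tau>_eq: "\<tau> = (if n mod 3 = 1 then 1 else -1)" if "Lambda n \<noteq> 0"
      unfolding \<tau>_def using sign_mod_3_eq[OF assms(1) n3] that G by simp
    have "(n mod 3 = 1 \<and> (2 * n) mod 3 = 2) \<or> (n mod 3 = 2 \<and> (2 * n) mod 3 = 1)"
      using n3 by presburger
    then consider "n mod 3 = 1" "(2 * n) mod 3 = 2" | "n mod 3 = 2" "(2 * n) mod 3 = 1"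
      by blast
    then show ?thesis
    proof cases
      case 1
      \<comment> \<open>With e = \<open>genus_sign n\<close>, the four coefficients factor as (1 +-
        e)(1 +- \<open>\<tau>\<close>)/2. The value 1 of \<open>\<tau>\<close> keeps those of
        (1,0,45) and (7,4,7), the forms attached to the nonempty sets in this case.\<close>
      have *: "Lambda n = 0 \<or> \<tau> = 1" using \<tau>_eq 1 by auto
      show ?thesis
        unfolding form_reps_1_0_45 form_reps_5_0_9 form_reps_7_4_7 form_reps_2_2_23
          sols_3_mod_1[OF 1(1)] sols_3_mod_2[OF 1(2)] card e \<tau> e\<tau>
        using True * by (auto simp: field_simps)
    next
      case 2
      have *: "Lambda n = 0 \<or> \<tau> = -1" using \<tau>_eq 2 by auto
      show ?thesis
        unfolding form_reps_1_0_45 form_reps_5_0_9 form_reps_7_4_7 form_reps_2_2_23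
          sols_3_mod_2[OF 2(1)] sols_3_mod_1[OF 2(2)] card e \<tau> e\<tau>
        using True * by (auto simp: field_simps)
    qed
  next
    case False
    then have "3 dvd n"
      using assms(3) not_dvd_imp_multiplicity_0[of 3 n] by auto
    then have d: "3 dvd n" "3 dvd 2 * n" by (simp_all add: dvd_mult)
    show ?thesis
    proof (cases "9 dvd n")
      case True
      then obtain l where "n = 9 * l" by (rule dvdE)
      then have l: "n = 3 * (3 * l)" by simp
      with assms(1) have l0: "l > 0" by simp
      \<comment> \<open>The prime 3 contributes -1, but n/l contains it twice.\<close>
      have sgn: "genus_sign n = genus_sign l"
        using l0 genus_sign_times_prime[of 3 "3 * l"] genus_sign_times_prime[of 3 l] by (simp add: l)
      have b: "b = 2 + multiplicity 3 l"
        using l0 assms(3) multiplicity_times_prime[of 3 3 "3 * l"] multiplicity_times_prime[of 3 3 l]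
        by (simp add: l)
      have "cofactor 3 (3 * (3 * l)) = cofactor 3 l"
        using l0 cofactor_times_prime[of 3 "3 * l"] cofactor_times_prime[of 3 l] by simp
      then have "Lambda n = Lambda l"
        using Lambda_eq_cofactor[OF assms(1)] Lambda_eq_cofactor[OF l0] unfolding l by simp
      \<comment> \<open>The factor of 3 in \<open>full_factor l\<close> is 1 + (b - 2) = b -
        1.\<close>
      then have "full_factor l = (real b - 1) * Lambda n"
        using full_factor_eq_Lambda[OF l0] by (simp add: b)
      then have card: "real (card (sols l)) = (real b - 1) * (1 + genus_sign n) * Lambda n"
        "real (card (sols (2 * l))) = (real b - 1) * (1 - genus_sign n) * Lambda n"
        using card_sols_formula[OF l0] sgn by simp_all
      have "2 * n = 9 * (2 * l)" using l by simp
      then show ?thesis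
        unfolding form_reps_1_0_45 form_reps_5_0_9 form_reps_7_4_7 form_reps_2_2_23 e
        using False card card_sols_3_nine_times[of l] card_sols_3_nine_times[of "2 * l"] \<open>n = 9 * l\<close>
        by simp
    next
      \<comment> \<open>Here \<open>b = 1\<close>, so the right-hand sides vanish; a solution would
        have both coordinates divisible by 3, which forces 9 to divide its value.\<close>
      case 9: False
      have "\<not> 9 dvd 2 * n" using 9 by presburger
      moreover have "b = 1"
      proof -
        have "\<not> 2 \<le> b"
          using 9 assms(3) multiplicity_dvd'[of 2 3 n] by auto
        with False show ?thesis by simp
      qed
      ultimately show ?thesis
        unfolding form_reps_1_0_45 form_reps_5_0_9 form_reps_7_4_7 form_reps_2_2_23
        using sols_3_empty[OF d(1) 9] sols_3_empty[OF d(2)] by simp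
    qed
  qed
qed

end
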